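(* Let $\mathcal{H}$ be a Hilbert space and suppose that $F=\{f_i\}_{i\in\mathbb{I}}$ is a Bessel sequence for $\mathcal{H}$, with associated bounded operator $S_F:\mathcal{H}\to\mathcal{H}$, $S_F(f)=\sum_i\langle f,f_i\rangle f_i$. Then the following statements are equivalent: 1. $F$ is a frame for $\mathcal{H}$. 2. There exist constants $A,B>0$ such that $A\|f\|\le\|S_F(f)\|\le B\|f\|$ for every $f\in\mathcal{H}$. 3. There exist constants $A,B>0$ such that $A\le S_F\le B$. 4. $S_F$ is injective and has closed range. 5. $S_F$ is surjective. 6. $S_F$ is invertible.
   Context: The index set $\mathbb{I}$ is countable. A family $F=\{f_i\}_{i\in\mathbb{I}}\subset\mathcal{H}$ is a Bessel sequence for $\mathcal{H}$ if there is $B>0$ such that $\sum_i|\langle f,f_i\rangle|^2\le B\|f\|^2$ for every $f\in\mathcal{H}$; it is a frame for $\mathcal{H}$ if there are $A,B>0$ such that $A\|f\|^2\le\sum_i|\langle f,f_i\rangle|^2\le B\|f\|^2$ for every $f\in\mathcal{H}$. For a Bessel sequence the series defining $S_F(f)$ converges for every $f\in\mathcal{H}$ and $S_F$ is bounded. For bounded operators $V,W$ on $\mathcal{H}$, $V\le W$ means $\langle V(f),f\rangle\le\langle W(f),f\rangle$ for every $f\in\mathcal{H}$; a scalar $A$ in such an inequality stands for $A\cdot I$, with $I$ the identity operator. Inner products are linear in the first variable. *)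

theory Defs
  imports "HOL-Analysis.Analysis" "HOL-Library.Nonpos_Ints"
begin

(* The scalar field of a Hilbert space.  Up to isometric isomorphism the only models are the
   real and the complex numbers: add_conjg and mult_conjg make every scalar a root of a monic
   real quadratic polynomial, and mult_conjg forces conjg to be the usual conjugation. *)
class rc_field = real_normed_field +
  fixes conjg :: "'a \<Rightarrow> 'a"
  assumes conjg_add: "conjg (x + y) = conjg x + conjg y"
    and conjg_mult: "conjg (x * y) = conjg x * conjg y"
    and conjg_conjg: "conjg (conjg x) = x"
    and conjg_of_real: "conjg (r *\<^sub>R 1) = r *\<^sub>R 1"
    and add_conjg: "\<exists>r. x + conjg x = r *\<^sub>R 1"
    and mult_conjg: "x * conjg x = (norm x)\<^sup>2 *\<^sub>R 1"

instantiation real :: rc_field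
begin

definition "conjg (x :: real) = x"

instance
  by standard (auto simp: conjg_real_def power2_eq_square)

end

instantiation complex :: rc_field
begin

definition "conjg (z :: complex) = cnj z"

instance
proof
  fix z :: complex
  show "\<exists>r. z + conjg z = r *\<^sub>R 1"
    unfolding conjg_complex_def complex_add_cnj of_real_def by blast
  show "z * conjg z = (norm z)\<^sup>2 *\<^sub>R 1"
    by (simp add: conjg_complex_def scaleR_conv_of_real complex_norm_square del: of_real_power)
qed (simp_all add: conjg_complex_def)

end

(* The space is a whole type; its class banach supplies the norm, the topology and completeness.
   The locale adds multiplication by scalars from 'k, which has to agree with scaleR on real
   scalars, and an inner product, linear in the first variable, that induces the norm. *)
locale hilbert_space = vector_space smul
  for smul :: "'k::rc_field \<Rightarrow> 'a::banach \<Rightarrow> 'a" +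
  fixes ip :: "'a \<Rightarrow> 'a \<Rightarrow> 'k"
  assumes smul_of_real: "smul (of_real r) x = r *\<^sub>R x"
    and ip_add_left: "ip (x + y) z = ip x z + ip y z"
    and ip_smul_left: "ip (smul c x) y = c * ip x y"
    and ip_conjg: "ip y x = conjg (ip x y)"
    and ip_self: "ip x x = of_real ((norm x)\<^sup>2)"

lemma hilbert_space_real: "hilbert_space scaleR (inner :: 'a::{real_inner,banach} \<Rightarrow> 'a \<Rightarrow> real)"
  by unfold_locales
    (auto simp: algebra_simps inner_commute conjg_real_def power2_norm_eq_inner)

lemma hilbert_space_complex: "hilbert_space (*) (\<lambda>x y :: complex. x * cnj y)"
  by unfold_locales
    (auto simp: algebra_simps conjg_complex_def scaleR_conv_of_real complex_norm_square
      simp del: of_real_power)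

(* Summability is required explicitly, since infsum is 0 on families that are not summable. *)
definition bessel_sequence :: "('a::banach \<Rightarrow> 'a \<Rightarrow> 'k::rc_field) \<Rightarrow> 'i set \<Rightarrow> ('i \<Rightarrow> 'a) \<Rightarrow> bool"
  where "bessel_sequence ip I F \<longleftrightarrow>
    (\<exists>B>0. \<forall>f. (\<lambda>i. (norm (ip f (F i)))\<^sup>2) summable_on I \<and>
      (\<Sum>\<^sub>\<infinity>i\<in>I. (norm (ip f (F i)))\<^sup>2) \<le> B * (norm f)\<^sup>2)"

definition is_frame :: "('a::banach \<Rightarrow> 'a \<Rightarrow> 'k::rc_field) \<Rightarrow> 'i set \<Rightarrow> ('i \<Rightarrow> 'a) \<Rightarrow> bool"
  where "is_frame ip I F \<longleftrightarrow>
    (\<exists>A>0. \<exists>B>0. \<forall>f. (\<lambda>i. (norm (ip f (F i)))\<^sup>2) summable_on I \<and>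
      A * (norm f)\<^sup>2 \<le> (\<Sum>\<^sub>\<infinity>i\<in>I. (norm (ip f (F i)))\<^sup>2) \<and>
      (\<Sum>\<^sub>\<infinity>i\<in>I. (norm (ip f (F i)))\<^sup>2) \<le> B * (norm f)\<^sup>2)"

definition frame_operator ::
    "('k::rc_field \<Rightarrow> 'a::banach \<Rightarrow> 'a) \<Rightarrow> ('a \<Rightarrow> 'a \<Rightarrow> 'k) \<Rightarrow> 'i set \<Rightarrow> ('i \<Rightarrow> 'a) \<Rightarrow> 'a \<Rightarrow> 'a"
  where "frame_operator smul ip I F f = (\<Sum>\<^sub>\<infinity>i\<in>I. smul (ip f (F i)) (F i))"

definition bounded_operator :: "('k::rc_field \<Rightarrow> 'a::banach \<Rightarrow> 'a) \<Rightarrow> ('a \<Rightarrow> 'a) \<Rightarrow> bool"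
  where "bounded_operator smul T \<longleftrightarrow>
    Vector_Spaces.linear smul smul T \<and> (\<exists>M. \<forall>f. norm (T f) \<le> M * norm f)"

definition invertible_operator :: "('k::rc_field \<Rightarrow> 'a::banach \<Rightarrow> 'a) \<Rightarrow> ('a \<Rightarrow> 'a) \<Rightarrow> bool"
  where "invertible_operator smul S \<longleftrightarrow> bounded_operator smul S \<and>
    (\<exists>T. bounded_operator smul T \<and> T \<circ> S = id \<and> S \<circ> T = id)"

(* Comparing two possibly complex scalars by \<le> means that their difference is real and
   nonnegative. *)
definition operator_le :: "('a::banach \<Rightarrow> 'a \<Rightarrow> 'k::rc_field) \<Rightarrow> ('a \<Rightarrow> 'a) \<Rightarrow> ('a \<Rightarrow> 'a) \<Rightarrow> bool"
  where "operator_le ip V W \<longleftrightarrow> (\<forall>f. ip (W f) f - ip (V f) f \<in> \<real>\<^sub>\<ge>\<^sub>0)"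

end

(* Let q f be the sum of |<f, f_i>|^2. The frame operator S is symmetric with <S f, f> = q f and
   |S f|^2 <= B q f, so a lower bound on q amounts to a lower bound |S f| >= A |f|. Such a bound
   on a closed invariant subspace R makes f |-> f - (S f - y) / B a contraction of R, so S maps R
   onto R. Conversely, if R = range S is closed, symmetry and Baire's theorem bound S below on R;
   hence S R = R, and injectivity then forces R to be the whole space. *)

theory Submission
  imports Defs
begin

section \<open>Summability in Banach spaces\<close>

text \<open>Finite sums of \<open>a\<close> outside a large finite set are small, so by
  \<open>le\<close> the finite partial sums of \<open>f\<close> form a Cauchy net, which converges
  by completeness.\<close>

lemma summable_on_norm_sum_power2_le:
  fixes f :: "'i \<Rightarrow> 'b::banach" and a :: "'i \<Rightarrow> real"
  assumes a: "a summable_on A" "\<And>i. i \<in> A \<Longrightarrow> a i \<ge> 0"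
    and C: "C > 0"
    and le: "\<And>J. finite J \<Longrightarrow> J \<subseteq> A \<Longrightarrow> (norm (sum f J))\<^sup>2 \<le> C * sum a J"
  shows "f summable_on A"
proof -
  have "\<exists>P. eventually P (finite_subsets_at_top A) \<and>
          (\<forall>J K. P J \<and> P K \<longrightarrow> dist (sum f J) (sum f K) < e)" if "e > 0" for e
  proof -
    \<comment> \<open>The factor 2 makes \<open>C * d\<close> strictly less than
      \<open>(e / 2)\<^sup>2\<close>, so partial sums beyond \<open>L\<close> stay within
      \<open>e / 2\<close> of the one over \<open>L\<close>.\<close>
    define d where "d = (e / 2)\<^sup>2 / (2 * C)"
    have "d > 0"
      using C that by (simp add: d_def)
    have "C * d < (e / 2)\<^sup>2"
      using C that by (simp add: d_def)
    obtain L where L: "finite L" "L \<subseteq> A" "dist (sum a L) (infsum a A) \<le> d"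
      using has_sum_finite_approximation[OF has_sum_infsum[OF a(1)] \<open>d > 0\<close>] by blast
    define P where "P J \<longleftrightarrow> finite J \<and> L \<subseteq> J \<and> J \<subseteq> A" for J
    have near: "dist (sum f J) (sum f L) < e / 2" if "P J" for J
    proof -
      have J: "finite J" "L \<subseteq> J" "J \<subseteq> A"
        using that by (auto simp: P_def)
      have "(dist (sum f J) (sum f L))\<^sup>2 = (norm (sum f (J - L)))\<^sup>2"
        using J by (simp add: dist_norm sum_diff)
      also have "\<dots> \<le> C * sum a (J - L)"
        using J by (intro le) auto
      also have "sum a (J - L) = sum a J - sum a L"
        using J by (simp add: sum_diff)
      also have "C * (sum a J - sum a L) \<le> C * d"
      proof -
        have "sum a J \<le> infsum a A"
          using J a by (intro finite_sum_le_infsum) auto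
        then show ?thesis
          using L(3) C by (simp add: dist_real_def)
      qed
      also have "\<dots> < (e / 2)\<^sup>2"
        by fact
      finally show ?thesis
        by (rule power2_less_imp_less) (use \<open>e > 0\<close> in simp)
    qed
    have "eventually P (finite_subsets_at_top A)"
      unfolding eventually_finite_subsets_at_top P_def using L by blast
    moreover have "dist (sum f J) (sum f K) < e" if "P J" "P K" for J K
      using near[OF that(1)] near[OF that(2)] dist_triangle_half_l by blast
    ultimately show ?thesis
      by blast
  qed
  then have "cauchy_filter (filtermap (sum f) (finite_subsets_at_top A))"
    by (simp add: cauchy_filter_metric_filtermap)
  moreover have "complete (UNIV :: 'b set)"
    by (rule complete_UNIV)
  ultimately obtain s where "(sum f \<longlongrightarrow> s) (finite_subsets_at_top A)"
    using complete_uniform[where S = UNIV] by (force simp: filterlim_def)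
  then show ?thesis
    using summable_on_def has_sum_def by blast
qed

section \<open>Inner product spaces over the real or complex scalars\<close>

lemma conjg_0 [simp]: "conjg (0 :: 'k::rc_field) = 0"
  using conjg_of_real[of 0, where 'a = 'k] by simp

lemma conjg_of_real' [simp]: "conjg (of_real r :: 'k::rc_field) = of_real r"
  by (simp add: of_real_def conjg_of_real)

lemma mult_conjg': "x * conjg x = (of_real ((norm x)\<^sup>2) :: 'k::rc_field)"
  by (simp only: of_real_def mult_conjg)

lemma norm_conjg [simp]: "norm (conjg (x :: 'k::rc_field)) = norm x"
proof (cases "x = 0")
  case False
  have "norm x * norm (conjg x) = norm x * norm x"
    by (simp only: norm_mult[symmetric] mult_conjg')
       (simp add: norm_mult power2_eq_square)
  then show ?thesis
    using False by simp
qed simp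

text \<open>Real linearity is enough to move conjugation through infinite sums, as the symmetry of
  the frame operator requires.\<close>

lemma bounded_linear_conjg: "bounded_linear (conjg :: 'k::rc_field \<Rightarrow> 'k)"
proof (rule bounded_linear_intro[where K = 1])
  fix r and x :: 'k
  show "conjg (r *\<^sub>R x) = r *\<^sub>R conjg x"
    by (simp add: scaleR_conv_of_real conjg_mult)
qed (simp_all add: conjg_add)

context hilbert_space
begin

lemma ip_scaleR_left: "ip (r *\<^sub>R x) y = of_real r * ip x y"
  using ip_smul_left[of "of_real r" x y] by (simp add: smul_of_real)

lemma ip_minus_left: "ip (- x) y = - ip x y"
  using ip_scaleR_left[of "-1" x y] by simp

lemma ip_diff_left: "ip (x - y) z = ip x z - ip y z"
  using ip_add_left[of x "- y" z] by (simp add: ip_minus_left)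

lemma ip_0_left [simp]: "ip 0 y = 0"
  using ip_diff_left[of 0 0 y] by simp

lemma ip_smul_right: "ip x (smul c y) = conjg c * ip x y"
  by (metis ip_conjg ip_smul_left conjg_mult)

lemma ip_add_right: "ip x (y + z) = ip x y + ip x z"
  by (metis ip_conjg ip_add_left conjg_add)

lemma ip_scaleR_right: "ip x (r *\<^sub>R y) = of_real r * ip x y"
  by (metis ip_conjg ip_scaleR_left conjg_mult conjg_of_real')

lemma ip_diff_right: "ip x (y - z) = ip x y - ip x z"
  using ip_add_right[of x y "(-1) *\<^sub>R z"] by (simp only: ip_scaleR_right) simp

lemma norm_ip_commute: "norm (ip x y) = norm (ip y x)"
  by (metis ip_conjg norm_conjg)

text \<open>Staying in the scalar field avoids real parts. In each application both cross terms are
  real scalars, so injectivity of \<open>of_real\<close> yields a real identity.\<close>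

lemma of_real_norm_diff_power2:
  "of_real ((norm (x - y))\<^sup>2) = of_real ((norm x)\<^sup>2) - ip x y - ip y x + of_real ((norm y)\<^sup>2)"
  by (simp only: ip_self[symmetric] ip_diff_left ip_diff_right) (simp add: algebra_simps)

lemma norm_ip_le: "norm (ip x y) \<le> norm x * norm y"
proof (cases "y = 0")
  case False
  \<comment> \<open>\<open>smul c y\<close> is the orthogonal projection of \<open>x\<close> onto
    the line through \<open>y\<close>, and \<open>m\<close> is its squared norm. Cauchy-Schwarz says
    that the remainder has squared norm at least 0.\<close>
  define c where "c = ip x y / of_real ((norm y)\<^sup>2)"
  define m where "m = (norm (ip x y))\<^sup>2 / (norm y)\<^sup>2"
  have yx: "ip x y * ip y x = of_real ((norm (ip x y))\<^sup>2)"
    by (subst (2) ip_conjg) (rule mult_conjg')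
  have "conjg c = ip y x / of_real ((norm y)\<^sup>2)"
    by (simp only: c_def divide_inverse of_real_inverse[symmetric] conjg_mult conjg_of_real'
        ip_conjg[of y x, symmetric])
  then have 1: "ip x (smul c y) = of_real m"
    using yx by (simp add: ip_smul_right m_def mult.commute)
  have 2: "ip (smul c y) x = of_real m"
    using 1 by (metis ip_conjg conjg_of_real')
  have 3: "(norm (smul c y))\<^sup>2 = m"
  proof -
    have "of_real ((norm (smul c y))\<^sup>2) = c * ip y (smul c y)"
      by (simp only: ip_self[symmetric] ip_smul_left)
    also have "\<dots> = (c * conjg c) * of_real ((norm y)\<^sup>2)"
      by (simp only: ip_smul_right ip_self mult.assoc)
    also have "\<dots> = of_real ((norm c)\<^sup>2 * (norm y)\<^sup>2)"
      by (simp only: mult_conjg' of_real_mult)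
    also have "(norm c)\<^sup>2 * (norm y)\<^sup>2 = m"
      using False by (simp add: c_def m_def norm_divide norm_mult power2_eq_square)
    finally show ?thesis
      by (simp only: of_real_eq_iff)
  qed
  have "of_real ((norm (x - smul c y))\<^sup>2) = (of_real ((norm x)\<^sup>2 - m) :: 'k)"
    unfolding of_real_norm_diff_power2 1 2 3 by simp
  then have "(norm (x - smul c y))\<^sup>2 = (norm x)\<^sup>2 - m"
    by (simp only: of_real_eq_iff)
  then have "m \<le> (norm x)\<^sup>2"
    using zero_le_power2[of "norm (x - smul c y)"] by linarith
  then have "(norm (ip x y))\<^sup>2 \<le> (norm x * norm y)\<^sup>2"
    using False by (simp add: m_def field_simps)
  then show ?thesis
    by (rule power2_le_imp_le) simp
qed (use ip_conjg[of x y] in simp)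

lemma bounded_linear_ip_left: "bounded_linear (\<lambda>x. ip x y)"
proof (rule bounded_linear_intro[where K = "norm y"])
  show "ip (r *\<^sub>R x) y = r *\<^sub>R ip x y" for r x
    by (simp add: ip_scaleR_left scaleR_conv_of_real)
qed (simp_all add: ip_add_left norm_ip_le)

lemma ip_left_eqI:
  assumes "\<And>z. ip x z = ip y z"
  shows "x = y"
proof -
  have "of_real ((norm (x - y))\<^sup>2) = ip (x - y) (x - y)"
    by (simp only: ip_self)
  also have "\<dots> = 0"
    using assms by (simp add: ip_diff_left)
  finally show ?thesis
    by simp
qed

end

section \<open>Positive operators\<close>

text \<open>\<open>q\<close> is the quadratic form of \<open>S\<close>. Linearity of
  \<open>S\<close> follows from symmetry, and boundedness by \<open>B\<close> from the last
  assumption.\<close>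

locale positive_operator = hilbert_space smul ip
  for smul :: "'k::rc_field \<Rightarrow> 'a::banach \<Rightarrow> 'a" and ip +
  fixes S :: "'a \<Rightarrow> 'a" and q :: "'a \<Rightarrow> real" and B :: real
  assumes sym: "ip (S x) y = ip x (S y)"
    and ip_S_self: "ip (S x) x = of_real (q x)"
    and B_pos: "B > 0"
    and norm_S_power2_le: "(norm (S x))\<^sup>2 \<le> B * q x"
begin

text \<open>Symmetry moves \<open>S\<close> into the second argument, where linearity in the first
  applies; inner products determine a vector.\<close>

lemma S_add: "S (x + y) = S x + S y"
  by (rule ip_left_eqI) (simp add: sym ip_add_left)

lemma S_smul: "S (smul c x) = smul c (S x)"
  by (rule ip_left_eqI) (simp add: sym ip_smul_left)

lemma S_scaleR: "S (r *\<^sub>R x) = r *\<^sub>R S x"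
  using S_smul[of "of_real r"] by (simp add: smul_of_real)

lemma S_diff: "S (x - y) = S x - S y"
  by (rule ip_left_eqI) (simp add: sym ip_diff_left)

lemma q_nonneg: "0 \<le> q x"
proof -
  have "0 \<le> B * q x"
    by (rule order_trans[OF zero_le_power2 norm_S_power2_le])
  then show ?thesis
    using B_pos by (simp add: zero_le_mult_iff)
qed

lemma q_le: "q x \<le> norm (S x) * norm x"
  using norm_ip_le[of "S x" x] by (simp add: ip_S_self q_nonneg)

lemma norm_S_le: "norm (S x) \<le> B * norm x"
proof (cases "S x = 0")
  case False
  have "norm (S x) * norm (S x) \<le> B * (norm (S x) * norm x)"
    using order_trans[OF norm_S_power2_le[of x] mult_left_mono[OF q_le[of x], of B]] B_pos
    by (simp add: power2_eq_square)
  then show ?thesis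
    using False by (simp add: algebra_simps)
qed (use B_pos in simp)

lemma linear_S: "Vector_Spaces.linear smul smul S"
  using vector_space_axioms by (simp add: Vector_Spaces.linear_iff S_add S_smul)

lemma bounded_operator_S: "bounded_operator smul S"
  using linear_S norm_S_le unfolding bounded_operator_def by blast

lemma bounded_linear_S: "bounded_linear S"
  by (rule bounded_linear_intro[where K = B])
    (simp_all add: S_add S_scaleR norm_S_le mult.commute)

text \<open>Forwards, \<open>q x \<le> norm (S x) * norm x\<close> allows cancelling
  \<open>norm x\<close>. Backwards, \<open>norm_S_power2_le\<close> turns the constant
  \<open>A\<close> into \<open>A\<^sup>2 / B\<close>.\<close>

lemma bounded_below_iff:
  "(\<exists>A>0. \<forall>x. A * (norm x)\<^sup>2 \<le> q x) \<longleftrightarrow> (\<exists>A>0. \<forall>x. A * norm x \<le> norm (S x))"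
proof
  assume "\<exists>A>0. \<forall>x. A * (norm x)\<^sup>2 \<le> q x"
  then obtain A where A: "A > 0" "\<And>x. A * (norm x)\<^sup>2 \<le> q x"
    by blast
  have "A * norm x \<le> norm (S x)" for x
  proof (cases "x = 0")
    case False
    have "(A * norm x) * norm x \<le> norm (S x) * norm x"
      using order_trans[OF A(2)[of x] q_le[of x]] by (simp add: power2_eq_square mult.assoc)
    then show ?thesis
      using False by simp
  qed simp
  with A(1) show "\<exists>A>0. \<forall>x. A * norm x \<le> norm (S x)"
    by blast
next
  assume "\<exists>A>0. \<forall>x. A * norm x \<le> norm (S x)"
  then obtain A where A: "A > 0" "\<And>x. A * norm x \<le> norm (S x)"
    by blast
  have "A\<^sup>2 / B * (norm x)\<^sup>2 \<le> q x" for x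
  proof -
    have "(A * norm x)\<^sup>2 \<le> B * q x"
      using A by (intro order_trans[OF power_mono norm_S_power2_le]) auto
    then show ?thesis
      using B_pos by (simp add: field_simps)
  qed
  moreover have "A\<^sup>2 / B > 0"
    using A B_pos by simp
  ultimately show "\<exists>A>0. \<forall>x. A * (norm x)\<^sup>2 \<le> q x"
    by blast
qed

text \<open>Expanding the square, the cross terms contribute \<open>- 2 * q x / B\<close> and the
  last square at most \<open>q x / B\<close>.\<close>

lemma norm_Richardson_step_power2_le: "(norm (x - (1 / B) *\<^sub>R S x))\<^sup>2 \<le> (norm x)\<^sup>2 - q x / B"
proof -
  let ?y = "(1 / B) *\<^sub>R S x"
  have "ip x ?y = of_real (q x / B)" "ip ?y x = of_real (q x / B)"
    using sym[of x x] by (simp_all add: ip_scaleR_left ip_scaleR_right ip_S_self)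
  then have "of_real ((norm (x - ?y))\<^sup>2) = (of_real ((norm x)\<^sup>2 - 2 * q x / B + (norm ?y)\<^sup>2) :: 'k)"
    by (simp only: of_real_norm_diff_power2) simp
  then have "(norm (x - ?y))\<^sup>2 = (norm x)\<^sup>2 - 2 * q x / B + (norm ?y)\<^sup>2"
    by (simp only: of_real_eq_iff)
  moreover have "(norm ?y)\<^sup>2 \<le> q x / B"
  proof -
    have "(norm ?y)\<^sup>2 = (norm (S x))\<^sup>2 / B\<^sup>2"
      by (simp add: power_divide)
    also have "\<dots> \<le> B * q x / B\<^sup>2"
      by (intro divide_right_mono norm_S_power2_le) simp
    also have "\<dots> = q x / B"
      by (simp add: power2_eq_square)
    finally show ?thesis .
  qed
  ultimately show ?thesis
    by simp
qed

text \<open>Fixed points of the Richardson map \<open>T\<close> are the solutions of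
  \<open>S x = y\<close>, so Banach's fixed point theorem on the complete set \<open>R\<close>
  applies. It serves for the whole space and for \<open>range S\<close>.\<close>

lemma subset_image_if_bounded_below:
  assumes R: "real_vector.subspace R" "closed R" "S ` R \<subseteq> R"
    and A: "A > 0" "\<And>x. x \<in> R \<Longrightarrow> A * norm x \<le> norm (S x)"
  shows "R \<subseteq> S ` R"
proof
  fix y
  assume "y \<in> R"
  define T where "T x = x - (1 / B) *\<^sub>R (S x - y)" for x
  \<comment> \<open>The squared contraction factor is \<open>1 - A\<^sup>2 / B\<^sup>2\<close>. The
    maximum covers \<open>R = {0}\<close>, where \<open>A\<close> may exceed
    \<open>B\<close>.\<close>
  define k where "k = sqrt (max 0 (1 - A\<^sup>2 / B\<^sup>2))"
  have k: "0 \<le> k" "k < 1"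
    using A B_pos by (auto simp: k_def)
  have contr: "dist (T x) (T z) \<le> k * dist x z" if "x \<in> R" "z \<in> R" for x z
  proof -
    let ?d = "x - z"
    have "?d \<in> R"
      using that R(1) by (rule real_vector.subspace_diff[rotated])
    have Td: "T x - T z = ?d - (1 / B) *\<^sub>R S ?d"
      by (simp add: T_def S_diff algebra_simps)
    have "(A * norm ?d)\<^sup>2 \<le> B * q ?d"
      using A \<open>?d \<in> R\<close> by (intro order_trans[OF power_mono norm_S_power2_le]) auto
    then have "A\<^sup>2 / B\<^sup>2 * (norm ?d)\<^sup>2 \<le> q ?d / B"
      using B_pos by (simp add: field_simps power2_eq_square)
    then have "(norm (T x - T z))\<^sup>2 \<le> (1 - A\<^sup>2 / B\<^sup>2) * (norm ?d)\<^sup>2"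
      using norm_Richardson_step_power2_le[of ?d] unfolding Td by (simp add: algebra_simps)
    also have "\<dots> \<le> k\<^sup>2 * (norm ?d)\<^sup>2"
      by (intro mult_right_mono) (auto simp: k_def)
    finally have "(norm (T x - T z))\<^sup>2 \<le> (k * norm ?d)\<^sup>2"
      by (simp only: power_mult_distrib)
    then have "norm (T x - T z) \<le> k * norm ?d"
      by (rule power2_le_imp_le) (use k(1) in simp)
    then show ?thesis
      by (simp only: dist_norm)
  qed
  have "T ` R \<subseteq> R"
    using R(3) \<open>y \<in> R\<close> unfolding T_def
    by (auto intro!: real_vector.subspace_diff[OF R(1)] real_vector.subspace_scale[OF R(1)])
  moreover have "complete R"
    using R(2) by (simp add: complete_eq_closed)
  ultimately have "\<exists>!x\<in>R. T x = x"
    using k contr \<open>y \<in> R\<close> by (intro Banach_fix) auto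
  then obtain x where "x \<in> R" "T x = x"
    by blast
  then show "y \<in> S ` R"
    using B_pos by (auto simp: T_def)
qed

text \<open>If \<open>y = S x\<close>, then \<open>ip y f = ip x (S f)\<close> is bounded by a multiple of \<open>norm (S f)\<close>; Baire's
  theorem makes this bound uniform on the closed range.\<close>

lemma bounded_below_on_closed_range:
  assumes "closed (range S)"
  obtains A where "A > 0" "\<And>x. x \<in> range S \<Longrightarrow> A * norm x \<le> norm (S x)"
proof -
  let ?R = "range S"
  let ?X = "top_of_set ?R"
  define E where "E k = {y \<in> ?R. \<forall>x. norm (ip y x) \<le> real k * norm (S x)}" for k :: nat
  have subsp: "real_vector.subspace ?R"
    by (intro linear_subspace_image bounded_linear.linear bounded_linear_S real_vector.subspace_UNIV)
  have "closedin ?X (E k)" for k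
  proof -
    have "E k = ?R \<inter> (\<Inter>x. {y. norm (ip y x) \<le> real k * norm (S x)})"
      by (auto simp: E_def)
    moreover have "closed (\<Inter>x. {y. norm (ip y x) \<le> real k * norm (S x)})"
      by (intro closed_INT ballI closed_Collect_le continuous_intros
          bounded_linear.continuous_on[OF bounded_linear_ip_left])
    ultimately show ?thesis
      by (simp only: closedin_closed_Int)
  qed
  moreover have "completely_metrizable_space ?X"
    using assms by (intro completely_metrizable_space_closedin completely_metrizable_space_euclidean)
      simp
  moreover have "(\<Union>k. E k) = ?R"
  proof -
    \<comment> \<open>By symmetry and Cauchy-Schwarz the norm of a preimage is a valid constant; it
      is rounded up to an index.\<close>
    have "S x \<in> E (nat \<lceil>norm x\<rceil>)" for x
    proof -
      have "norm (ip (S x) y) \<le> real (nat \<lceil>norm x\<rceil>) * norm (S y)" for y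
        unfolding sym by (rule order_trans[OF norm_ip_le mult_right_mono])
          (auto simp: real_nat_ceiling_ge)
      then show ?thesis
        by (simp add: E_def)
    qed
    moreover have "E k \<subseteq> ?R" for k
      by (auto simp: E_def)
    ultimately show ?thesis
      by blast
  qed
  \<comment> \<open>Otherwise Baire's theorem would give the union, which is the whole nonempty
    range, empty interior in itself.\<close>
  ultimately have "\<exists>k. ?X interior_of (E k) \<noteq> {}"
    using Baire_category_alt[of ?X "range E"] interior_of_topspace[of ?X] by auto
  then obtain k where "?X interior_of (E k) \<noteq> {}"
    by blast
  then obtain U y where U: "openin ?X U" "U \<subseteq> E k" "y \<in> U"
    by (auto simp: interior_of_def)
  then obtain r where r: "r > 0" "ball y r \<inter> ?R \<subseteq> U"
    unfolding openin_contains_ball by blast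
  have y: "y \<in> E k"
    using U by blast
  \<comment> \<open>The ball is moved from \<open>y\<close> to 0: \<open>z\<close> is the difference
    of \<open>y + z\<close> and \<open>y\<close>, both in \<open>E k\<close>, hence the factor
    2.\<close>
  have bound: "norm (ip z x) \<le> 2 * real k * norm (S x)" if "z \<in> ?R" "norm z < r" for x z
  proof -
    have "y + z \<in> ?R"
      using that(1) y by (intro real_vector.subspace_add[OF subsp]) (auto simp: E_def)
    moreover have "y + z \<in> ball y r"
      using that(2) by (simp add: dist_norm)
    ultimately have "y + z \<in> E k"
      using r(2) U(2) by blast
    then have "norm (ip (y + z) x - ip y x) \<le> real k * norm (S x) + real k * norm (S x)"
      using y unfolding E_def by (intro order_trans[OF norm_triangle_ineq4] add_mono) auto
    then show ?thesis
      by (simp add: ip_add_left)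
  qed
  \<comment> \<open>Rescaling \<open>x\<close> to norm \<open>r / 2\<close> and pairing it with
    \<open>x\<close> itself gives \<open>r / 2 * norm x \<le> 2 * real k * norm (S x)\<close>.
    Adding 1 to \<open>k\<close> avoids a zero denominator.\<close>
  define A where "A = r / (4 * (real k + 1))"
  have "A > 0"
    using r(1) by (simp add: A_def)
  moreover have "A * norm x \<le> norm (S x)" if "x \<in> ?R" for x
  proof (cases "x = 0")
    case False
    define s where "s = r / (2 * norm x)"
    have s: "s > 0" "norm (s *\<^sub>R x) < r" "s *\<^sub>R x \<in> ?R"
      using False r(1) that by (auto simp: s_def intro: real_vector.subspace_scale[OF subsp])
    have "norm (ip (s *\<^sub>R x) x) = s * (norm x)\<^sup>2"
      using s(1) by (simp add: ip_scaleR_left ip_self norm_mult norm_power)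
    also have "\<dots> = r / 2 * norm x"
      using False by (simp add: s_def power2_eq_square)
    finally have "r / 2 * norm x \<le> 2 * real k * norm (S x)"
      using bound[OF s(3,2), of x] by simp
    also have "\<dots> \<le> 2 * (real k + 1) * norm (S x)"
      by (intro mult_right_mono) auto
    finally show ?thesis
      by (simp add: A_def field_simps)
  qed simp
  ultimately show thesis
    by (rule that)
qed

section \<open>Equivalent forms of the lower bound on \<open>S\<close>\<close>

lemma surj_if_bounded_below:
  assumes "A > 0" "\<And>x. A * norm x \<le> norm (S x)"
  shows "surj S"
  using subset_image_if_bounded_below[OF real_vector.subspace_UNIV closed_UNIV subset_UNIV assms]
  by (rule top.extremum_uniqueI)

lemma inj_if_bounded_below:
  assumes "A > 0" "\<And>x. A * norm x \<le> norm (S x)"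
  shows "inj S"
proof (rule injI)
  fix x y
  assume "S x = S y"
  then have "A * norm (x - y) \<le> 0"
    using assms(2)[of "x - y"] by (simp add: S_diff)
  then show "x = y"
    using assms(1) by (simp add: mult_le_0_iff)
qed

text \<open>The lower bound on the closed range makes \<open>S\<close> map \<open>range S\<close>
  onto itself. Thus each \<open>S x\<close> equals some \<open>S (S z)\<close>, and injectivity
  gives \<open>x = S z\<close>.\<close>

lemma surj_if_inj_closed_range:
  assumes "inj S" "closed (range S)"
  shows "surj S"
proof -
  obtain A where A: "A > 0" "\<And>x. x \<in> range S \<Longrightarrow> A * norm x \<le> norm (S x)"
    using bounded_below_on_closed_range[OF assms(2)] by blast
  have "real_vector.subspace (range S)"
    by (intro linear_subspace_image bounded_linear.linear bounded_linear_S real_vector.subspace_UNIV)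
  then have "range S \<subseteq> S ` range S"
    using assms(2) A by (intro subset_image_if_bounded_below) auto
  then show ?thesis
    using assms(1) by (blast dest: injD)
qed

text \<open>For surjective \<open>S\<close> the range is the whole space, hence closed, and the
  lower bound on the range holds everywhere.\<close>

lemma bounded_below_iff_surj: "(\<exists>A>0. \<forall>x. A * norm x \<le> norm (S x)) \<longleftrightarrow> surj S"
proof
  assume "surj S"
  then have "closed (range S)"
    by simp
  then obtain A where "A > 0" "\<And>x. x \<in> range S \<Longrightarrow> A * norm x \<le> norm (S x)"
    using bounded_below_on_closed_range by blast
  with \<open>surj S\<close> show "\<exists>A>0. \<forall>x. A * norm x \<le> norm (S x)"
    by auto
qed (use surj_if_bounded_below in blast)

lemma bounded_below_iff_inj_closed_range:
  "(\<exists>A>0. \<forall>x. A * norm x \<le> norm (S x)) \<longleftrightarrow> inj S \<and> closed (range S)"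
proof
  assume *: "\<exists>A>0. \<forall>x. A * norm x \<le> norm (S x)"
  then have "surj S"
    by (simp only: bounded_below_iff_surj)
  with * show "inj S \<and> closed (range S)"
    using inj_if_bounded_below by auto
qed (simp add: bounded_below_iff_surj surj_if_inj_closed_range)

text \<open>A lower bound \<open>A\<close> makes \<open>S\<close> bijective and bounds the inverse
  by \<open>1 / A\<close>. Conversely, a right inverse gives surjectivity.\<close>

lemma bounded_below_iff_invertible:
  "(\<exists>A>0. \<forall>x. A * norm x \<le> norm (S x)) \<longleftrightarrow> invertible_operator smul S"
proof
  assume "\<exists>A>0. \<forall>x. A * norm x \<le> norm (S x)"
  then obtain A where A: "A > 0" "\<And>x. A * norm x \<le> norm (S x)"
    by blast
  have inj: "inj S" and surj: "surj S"
    using A inj_if_bounded_below surj_if_bounded_below by blast+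
  have S_inv: "S (inv S x) = x" for x
    using surj by (rule surj_f_inv_f)
  have "inv S (x + y) = inv S x + inv S y" "inv S (smul c x) = smul c (inv S x)" for c x y
    by (rule injD[OF inj], simp add: S_inv S_add S_smul)+
  then have "Vector_Spaces.linear smul smul (inv S)"
    using vector_space_axioms by (simp add: Vector_Spaces.linear_iff)
  moreover have "norm (inv S x) \<le> 1 / A * norm x" for x
    using A(1) A(2)[of "inv S x"] by (simp add: S_inv field_simps)
  ultimately have "bounded_operator smul (inv S)"
    unfolding bounded_operator_def by blast
  then show "invertible_operator smul S"
    unfolding invertible_operator_def
    using bounded_operator_S inj surj by (auto simp: fun_eq_iff S_inv intro!: exI[of _ "inv S"])
next
  assume "invertible_operator smul S"
  then have "surj S"
    unfolding invertible_operator_def by (metis comp_apply id_apply surjI)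
  then show "\<exists>A>0. \<forall>x. A * norm x \<le> norm (S x)"
    by (simp add: bounded_below_iff_surj)
qed

end

section \<open>The frame operator\<close>

text \<open>With one Bessel bound \<open>B\<close> fixed, the same constant serves as the
  \<open>B\<close> of \<open>positive_operator\<close>.\<close>

locale bessel_family = hilbert_space smul ip
  for smul :: "'k::rc_field \<Rightarrow> 'a::banach \<Rightarrow> 'a" and ip +
  fixes I :: "'i set" and F :: "'i \<Rightarrow> 'a" and B :: real
  assumes B_pos: "B > 0"
    and summable: "(\<lambda>i. (norm (ip x (F i)))\<^sup>2) summable_on I"
    and infsum_le: "(\<Sum>\<^sub>\<infinity>i\<in>I. (norm (ip x (F i)))\<^sup>2) \<le> B * (norm x)\<^sup>2"
begin

abbreviation "S \<equiv> frame_operator smul ip I F"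
abbreviation "q x \<equiv> \<Sum>\<^sub>\<infinity>i\<in>I. (norm (ip x (F i)))\<^sup>2"

lemma ip_synthesis: "ip (\<Sum>i\<in>J. smul (c i) (F i)) y = (\<Sum>i\<in>J. c i * ip (F i) y)"
proof -
  interpret bounded_linear "\<lambda>x. ip x y"
    by (rule bounded_linear_ip_left)
  show ?thesis
    by (simp add: sum ip_smul_left)
qed

text \<open>Duality: pairing the sum \<open>v\<close> with itself and using Cauchy-Schwarz for
  finite sums bounds \<open>norm v\<close> to the fourth power by the Bessel bound times
  \<open>(norm v)\<^sup>2\<close>, which cancels.\<close>

lemma norm_synthesis_power2_le:
  assumes "finite J" "J \<subseteq> I"
  shows "(norm (\<Sum>i\<in>J. smul (c i) (F i)))\<^sup>2 \<le> B * (\<Sum>i\<in>J. (norm (c i))\<^sup>2)"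
proof -
  define v where "v = (\<Sum>i\<in>J. smul (c i) (F i))"
  have "(norm v)\<^sup>2 = norm (ip v v)"
    by (simp add: ip_self norm_power)
  also have "\<dots> = norm (\<Sum>i\<in>J. c i * ip (F i) v)"
    by (subst (1) v_def) (simp only: ip_synthesis)
  also have "\<dots> \<le> (\<Sum>i\<in>J. norm (c i) * norm (ip v (F i)))"
    by (rule order_trans[OF norm_sum]) (simp add: norm_mult norm_ip_commute[of v])
  finally have "((norm v)\<^sup>2)\<^sup>2 \<le> (\<Sum>i\<in>J. norm (c i) * norm (ip v (F i)))\<^sup>2"
    by (rule power_mono) simp
  also have "\<dots> \<le> (\<Sum>i\<in>J. (norm (c i))\<^sup>2) * (\<Sum>i\<in>J. (norm (ip v (F i)))\<^sup>2)"
    by (rule Cauchy_Schwarz_ineq_sum)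
  also have "(\<Sum>i\<in>J. (norm (ip v (F i)))\<^sup>2) \<le> q v"
    using assms by (intro finite_sum_le_infsum summable) auto
  also have "\<dots> \<le> B * (norm v)\<^sup>2"
    by (rule infsum_le)
  finally have le: "((norm v)\<^sup>2)\<^sup>2 \<le> (\<Sum>i\<in>J. (norm (c i))\<^sup>2) * (B * (norm v)\<^sup>2)"
    by (simp add: mult_left_mono sum_nonneg)
  show ?thesis
  proof (cases "v = 0")
    case True
    then show ?thesis
      using B_pos by (simp add: v_def[symmetric] sum_nonneg)
  next
    case False
    have "(norm v)\<^sup>2 * (norm v)\<^sup>2 \<le> (B * (\<Sum>i\<in>J. (norm (c i))\<^sup>2)) * (norm v)\<^sup>2"
      using le by (simp only: power2_eq_square[of "(norm v)\<^sup>2"] ac_simps)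
    moreover have "(norm v)\<^sup>2 > 0"
      using False by simp
    ultimately show ?thesis
      unfolding v_def[symmetric] by (rule mult_right_le_imp_le)
  qed
qed

text \<open>The synthesis estimate with coefficients \<open>ip x (F i)\<close> is the summability
  criterion, so the \<open>infsum\<close> defining \<open>S x\<close> is a true limit and not a
  default 0.\<close>

lemma has_sum_frame_operator: "((\<lambda>i. smul (ip x (F i)) (F i)) has_sum S x) I"
proof -
  have "(\<lambda>i. smul (ip x (F i)) (F i)) summable_on I"
    using B_pos
    by (intro summable_on_norm_sum_power2_le[where C = B, OF summable[of x]] norm_synthesis_power2_le) auto
  then show ?thesis
    unfolding frame_operator_def by (rule has_sum_infsum)
qed

lemma has_sum_ip_frame_operator: "((\<lambda>i. ip x (F i) * ip (F i) y) has_sum ip (S x) y) I"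
  using has_sum_bounded_linear[OF bounded_linear_ip_left[of y] has_sum_frame_operator[of x]]
  by (simp add: ip_smul_left)

text \<open>Each finite partial sum obeys the bound by the synthesis estimate, and the limit
  inherits it.\<close>

lemma norm_frame_operator_power2_le: "(norm (S x))\<^sup>2 \<le> B * q x"
proof -
  let ?s = "sum (\<lambda>i. smul (ip x (F i)) (F i))"
  have "((\<lambda>J. (norm (?s J))\<^sup>2) \<longlongrightarrow> (norm (S x))\<^sup>2) (finite_subsets_at_top I)"
    using has_sum_frame_operator[of x] unfolding has_sum_def by (intro tendsto_intros)
  moreover have "(norm (?s J))\<^sup>2 \<le> B * q x" if "finite J" "J \<subseteq> I" for J
  proof -
    have "(\<Sum>i\<in>J. (norm (ip x (F i)))\<^sup>2) \<le> q x"
      using that by (intro finite_sum_le_infsum summable) auto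
    then show ?thesis
      using norm_synthesis_power2_le[OF that, of "\<lambda>i. ip x (F i)"] B_pos
      by (meson mult_left_mono order_trans less_imp_le)
  qed
  ultimately show ?thesis
    by (rule tendsto_upperbound[OF _ eventually_finite_subsets_at_top_weakI
          finite_subsets_at_top_neq_bot])
qed

sublocale positive_operator smul ip S q B
proof
  fix x y
  \<comment> \<open>Conjugating the series for \<open>ip (S y) x\<close> term by term produces the
    series for \<open>ip (S x) y\<close>.\<close>
  have "((\<lambda>i. conjg (ip y (F i) * ip (F i) x)) has_sum conjg (ip (S y) x)) I"
    by (intro has_sum_bounded_linear[OF bounded_linear_conjg] has_sum_ip_frame_operator)
  moreover have "conjg (ip y (F i) * ip (F i) x) = ip x (F i) * ip (F i) y" for i
    by (simp only: conjg_mult ip_conjg[symmetric] mult.commute)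
  ultimately have "((\<lambda>i. ip x (F i) * ip (F i) y) has_sum ip x (S y)) I"
    by (simp only: ip_conjg[symmetric])
  then show "ip (S x) y = ip x (S y)"
    by (rule has_sum_unique[OF has_sum_ip_frame_operator])
next
  fix x
  have "ip x (F i) * ip (F i) x = of_real ((norm (ip x (F i)))\<^sup>2)" for i
    by (subst (2) ip_conjg) (rule mult_conjg')
  then have "((\<lambda>i. of_real ((norm (ip x (F i)))\<^sup>2)) has_sum ip (S x) x) I"
    using has_sum_ip_frame_operator[of x x] by simp
  then show "ip (S x) x = of_real (q x)"
    by (rule has_sum_unique) (intro has_sum_of_real has_sum_infsum summable)
qed (fact B_pos norm_frame_operator_power2_le)+

text \<open>Summability and the upper frame bound come from the Bessel property, leaving only the
  lower bound.\<close>

lemma is_frame_iff: "is_frame ip I F \<longleftrightarrow> (\<exists>A>0. \<forall>x. A * (norm x)\<^sup>2 \<le> q x)"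
proof
  assume "is_frame ip I F"
  then show "\<exists>A>0. \<forall>x. A * (norm x)\<^sup>2 \<le> q x"
    unfolding is_frame_def by blast
next
  assume "\<exists>A>0. \<forall>x. A * (norm x)\<^sup>2 \<le> q x"
  then show "is_frame ip I F"
    unfolding is_frame_def using B_pos summable infsum_le by metis
qed

text \<open>The difference of inner products is always a real scalar, so the operator inequality
  reduces to a real one.\<close>

lemma operator_le_scaleR_S_iff:
  "operator_le ip (\<lambda>x. A *\<^sub>R x) S \<longleftrightarrow> (\<forall>x. A * (norm x)\<^sup>2 \<le> q x)"
proof -
  have "ip (S x) x - ip (A *\<^sub>R x) x = of_real (q x - A * (norm x)\<^sup>2)" for x
    by (simp only: ip_S_self ip_scaleR_left ip_self of_real_diff of_real_mult)
  then show ?thesis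
    unfolding operator_le_def by (simp only: nonneg_Reals_of_real_iff) simp
qed

lemma operator_le_S_scaleR: "operator_le ip S (\<lambda>x. B *\<^sub>R x)"
proof -
  have "ip (B *\<^sub>R x) x - ip (S x) x = of_real (B * (norm x)\<^sup>2 - q x)" for x
    by (simp only: ip_S_self ip_scaleR_left ip_self of_real_diff of_real_mult)
  then show ?thesis
    unfolding operator_le_def by (simp only: nonneg_Reals_of_real_iff) (simp add: infsum_le)
qed

end

theorem corollary2p8:
  fixes smul :: "'k::rc_field \<Rightarrow> 'a::banach \<Rightarrow> 'a"
    and ip :: "'a \<Rightarrow> 'a \<Rightarrow> 'k"
    and I :: "'i set"
    and F :: "'i \<Rightarrow> 'a"
  assumes "hilbert_space smul ip"
    and "countable I"
    and "bessel_sequence ip I F"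
  shows "let S = frame_operator smul ip I F in
         (is_frame ip I F \<longleftrightarrow>
            (\<exists>A>0. \<exists>B>0. \<forall>f. A * norm f \<le> norm (S f) \<and> norm (S f) \<le> B * norm f)) \<and>
         (is_frame ip I F \<longleftrightarrow>
            (\<exists>A>0. \<exists>B>0. operator_le ip (\<lambda>f. A *\<^sub>R f) S \<and> operator_le ip S (\<lambda>f. B *\<^sub>R f))) \<and>
         (is_frame ip I F \<longleftrightarrow> inj S \<and> closed (range S)) \<and>
         (is_frame ip I F \<longleftrightarrow> surj S) \<and>
         (is_frame ip I F \<longleftrightarrow> invertible_operator smul S)"
proof -
  obtain B where B: "B > 0" "\<And>x. (\<lambda>i. (norm (ip x (F i)))\<^sup>2) summable_on I"
    "\<And>x. (\<Sum>\<^sub>\<infinity>i\<in>I. (norm (ip x (F i)))\<^sup>2) \<le> B * (norm x)\<^sup>2"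
    using assms(3) unfolding bessel_sequence_def by blast
  interpret bessel_family smul ip I F B
    by (intro bessel_family.intro bessel_family_axioms.intro assms(1) B)
  \<comment> \<open>The lower bound on \<open>norm (S x)\<close> links the frame property to the
    remaining conditions; upper bounds hold with the Bessel bound \<open>B\<close>.\<close>
  have frame: "is_frame ip I F \<longleftrightarrow> (\<exists>A>0. \<forall>x. A * norm x \<le> norm (S x))"
    by (simp only: is_frame_iff bounded_below_iff)
  moreover have "is_frame ip I F \<longleftrightarrow>
      (\<exists>A>0. \<exists>B>0. \<forall>f. A * norm f \<le> norm (S f) \<and> norm (S f) \<le> B * norm f)"
    unfolding frame using B_pos norm_S_le by blast
  moreover have "is_frame ip I F \<longleftrightarrow>
      (\<exists>A>0. \<exists>B>0. operator_le ip (\<lambda>f. A *\<^sub>R f) S \<and> operator_le ip S (\<lambda>f. B *\<^sub>R f))"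
    unfolding is_frame_iff operator_le_scaleR_S_iff using B_pos operator_le_S_scaleR by blast
  ultimately show ?thesis
    unfolding Let_def
    using bounded_below_iff_inj_closed_range bounded_below_iff_surj bounded_below_iff_invertible
    by blast
qed

end
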